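(* (i) For every real number $\beta>1$ there is a number $\theta_\beta$ with irrationality base $\beta(\theta_\beta)=\beta$ which is approximable to order $\beta^{-x}$. In fact, any continued fraction $\theta_\beta=[0;b_1,b_2,\ldots]$, with $n$-th convergent $p_n/q_n$, which satisfies $$b_{n+1}\,\omega(q_n)\,q_n^2>1\quad(n\ge0),\qquad \lim_{n\to\infty}b_{n+1}\,\omega(q_n)\,q_n^2=1$$ with $\omega(x)=\beta^{-x}$ has these properties. (ii) For every real number $\mu>2$ there is a number $\theta$ with irrationality exponent $\mu(\theta)=\mu$ which is approximable to order $x^{-\mu}$. In fact, any continued fraction $\theta=[0;b_1,b_2,\ldots]$, with $n$-th convergent $p_n/q_n$, which satisfies $$b_{n+1}\,\omega(q_n)\,q_n^2>1\quad(n\ge0),\qquad \lim_{n\to\infty}b_{n+1}\,\omega(q_n)\,q_n^2=1$$ with $\omega(x)=x^{-\mu}$ has these properties.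
   Context: Irrationality exponent: for a real irrational number $\alpha$, $\mu(\alpha)$ is the least real $\mu>0$ such that for every $\varepsilon>0$ there is a positive integer $q(\varepsilon)$ with $\left|\alpha-\frac pq\right|>q^{-(\mu+\varepsilon)}$ for all integers $p,q$ with $q\ge q(\varepsilon)$; if no such $\mu$ exists, $\mu(\alpha)=\infty$. Irrationality base: $\beta(\alpha)$ is the least real $\beta\ge 1$ such that for every $\varepsilon>0$ there is a positive integer $q(\varepsilon)$ with $\left|\alpha-\frac pq\right|>\frac{1}{(\beta+\varepsilon)^q}$ for all integers $p,q$ with $q\ge q(\varepsilon)$; if no such $\beta$ exists, $\beta(\alpha)=\infty$. Given a real number $\theta$ and a positive real-valued function $\omega(x)$ defined for $x\ge1$, $\theta$ is approximable to order $\omega$ if for every $C>0$ there exists a pair of integers $p,q$, with $q>C$, such that $\left|\theta-\frac pq\right|<\omega(q)$. Conventions: continued fractions $[0;b_1,b_2,\ldots]=\cfrac{1}{b_1+\cfrac{1}{b_2+\cdots}}$ are simple and infinite, with positive integer partial quotients $b_1,b_2,\ldots$; the $n$-th convergent $p_n/q_n=[0;b_1,\ldots,b_n]$ is in lowest terms with $q_n>0$ (so $q_0=1$, $q_1=b_1$, $q_{n+1}=b_{n+1}q_n+q_{n-1}$). *)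

theory Defs
  imports Complex_Main "HOL-Library.Extended_Real"
begin

definition exponent_bound :: "real \<Rightarrow> real \<Rightarrow> bool" where
  "exponent_bound \<alpha> m \<longleftrightarrow> m > 0 \<and>
     (\<forall>\<epsilon>>0. \<exists>Q::int. Q > 0 \<and>
        (\<forall>p q::int. q \<ge> Q \<longrightarrow> \<bar>\<alpha> - of_int p / of_int q\<bar> > of_int q powr (-(m + \<epsilon>))))"

(* Both measures are meant for irrational numbers.  At a rational number there is no
   bound at all, because p/q equals it for arbitrarily large q, so the value is \<infinity>. *)
definition irrationality_exponent :: "real \<Rightarrow> ereal" where
  "irrationality_exponent \<alpha> =
     (if \<exists>m. exponent_bound \<alpha> m \<and> (\<forall>m'. exponent_bound \<alpha> m' \<longrightarrow> m \<le> m')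
      then ereal (LEAST m. exponent_bound \<alpha> m) else \<infinity>)"

definition base_bound :: "real \<Rightarrow> real \<Rightarrow> bool" where
  "base_bound \<alpha> b \<longleftrightarrow> b \<ge> 1 \<and>
     (\<forall>\<epsilon>>0. \<exists>Q::int. Q > 0 \<and>
        (\<forall>p q::int. q \<ge> Q \<longrightarrow> \<bar>\<alpha> - of_int p / of_int q\<bar> > 1 / (b + \<epsilon>) powi q))"

definition irrationality_base :: "real \<Rightarrow> ereal" where
  "irrationality_base \<alpha> =
     (if \<exists>b. base_bound \<alpha> b \<and> (\<forall>b'. base_bound \<alpha> b' \<longrightarrow> b \<le> b')
      then ereal (LEAST b. base_bound \<alpha> b) else \<infinity>)"

(* Only the values of \<omega> on [1, \<infinity>) matter; \<omega> is meant to be positive there. *)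
definition approximable_to_order :: "real \<Rightarrow> (real \<Rightarrow> real) \<Rightarrow> bool" where
  "approximable_to_order \<theta> \<omega> \<longleftrightarrow>
     (\<forall>C::real>0. \<exists>p q::int. of_int q > C \<and> \<bar>\<theta> - of_int p / of_int q\<bar> < \<omega> (of_int q))"

(* The finite continued fraction [0; b1, ..., bn] for the list [b1, ..., bn]. *)
fun finite_cf :: "nat list \<Rightarrow> rat" where
  "finite_cf [] = 0"
| "finite_cf (b # bs) = 1 / (of_nat b + finite_cf bs)"

(* A sequence b stands for [0; b 1, b 2, ...]; the entry b 0 is ignored throughout. *)
definition partial_quotients :: "(nat \<Rightarrow> nat) \<Rightarrow> bool" where
  "partial_quotients b \<longleftrightarrow> (\<forall>n\<ge>1. b n > 0)"

definition convergent_cf :: "(nat \<Rightarrow> nat) \<Rightarrow> nat \<Rightarrow> rat" where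
  "convergent_cf b n = finite_cf (map b [1..<Suc n])"

definition cf_value :: "(nat \<Rightarrow> nat) \<Rightarrow> real" where
  "cf_value b = lim (\<lambda>n. of_rat (convergent_cf b n))"

definition cf_denom :: "(nat \<Rightarrow> nat) \<Rightarrow> nat \<Rightarrow> int" where
  "cf_denom b n = snd (quotient_of (convergent_cf b n))"

definition growth_condition :: "(real \<Rightarrow> real) \<Rightarrow> (nat \<Rightarrow> nat) \<Rightarrow> bool" where
  "growth_condition \<omega> b \<longleftrightarrow>
     (\<forall>n. of_nat (b (Suc n)) * \<omega> (of_int (cf_denom b n)) * (of_int (cf_denom b n))\<^sup>2 > 1) \<and>
     (\<lambda>n. of_nat (b (Suc n)) * \<omega> (of_int (cf_denom b n)) * (of_int (cf_denom b n))\<^sup>2)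
       \<longlonglongrightarrow> 1"

end

theory Submission
  imports Defs "HOL-Real_Asymp.Real_Asymp"
begin

text \<open>Write \<open>\<theta>\<close> for the value of the continued fraction. The growth condition says that \<open>q\<^bsub>n+1\<^esub>\<close> is
  comparable to \<open>1 / (\<omega>(q\<^sub>n) q\<^sub>n)\<close>. Since \<open>\<bar>\<theta> - p\<^sub>n/q\<^sub>n\<bar> \<le> 1 / (q\<^sub>n q\<^bsub>n+1\<^esub>) < \<omega>(q\<^sub>n)\<close>, the number is
  approximable to order \<open>\<omega>\<close>, so neither measure can be smaller than claimed. Conversely, if
  \<open>q\<^sub>n \<le> q < q\<^bsub>n+1\<^esub>\<close>, then by the law of best approximation
  \<open>\<bar>q\<theta> - p\<bar> \<ge> \<bar>q\<^sub>n\<theta> - p\<^sub>n\<bar> \<ge> 1 / (q\<^sub>n + q\<^bsub>n+1\<^esub>) \<ge> \<omega>(q\<^sub>n) q\<^sub>n / 6\<close> for large \<open>n\<close>. For the two choices of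
  \<open>\<omega>\<close> this gives \<open>\<bar>\<theta> - p/q\<bar> \<ge> \<beta>\<^sup>-\<^sup>q / (6 q)\<close> and \<open>\<bar>\<theta> - p/q\<bar> \<ge> q\<^sup>-\<^sup>\<mu> / 6\<close>, which are the upper
  bounds for the measures and also exclude that \<open>\<theta>\<close> is rational.\<close>

section \<open>Convergents\<close>

text \<open>The classical recurrence for the convergents, started at indices 0 and 1 so that neither
  index -1 nor the entry \<open>b 0\<close> enters.\<close>

fun cf_num :: "(nat \<Rightarrow> nat) \<Rightarrow> nat \<Rightarrow> nat" where
  "cf_num b 0 = 0"
| "cf_num b (Suc 0) = 1"
| "cf_num b (Suc (Suc n)) = b (Suc (Suc n)) * cf_num b (Suc n) + cf_num b n"

fun cf_den :: "(nat \<Rightarrow> nat) \<Rightarrow> nat \<Rightarrow> nat" where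
  "cf_den b 0 = 1"
| "cf_den b (Suc 0) = b 1"
| "cf_den b (Suc (Suc n)) = b (Suc (Suc n)) * cf_den b (Suc n) + cf_den b n"

text \<open>One step of the recurrence adds a multiple of one column of the 2x2 matrix to the other
  and swaps them, which flips the sign.\<close>

lemma cf_determinant:
  "int (cf_num b (Suc n)) * int (cf_den b n) - int (cf_num b n) * int (cf_den b (Suc n)) = (-1) ^ n"
  by (induction n) (simp_all add: algebra_simps)

lemma cf_determinant_real:
  "real (cf_num b (Suc n)) * real (cf_den b n) - real (cf_num b n) * real (cf_den b (Suc n)) = (-1) ^ n"
proof -
  have "real_of_int (int (cf_num b (Suc n)) * int (cf_den b n) - int (cf_num b n) * int (cf_den b (Suc n)))
      = real_of_int ((-1) ^ n)"
    by (simp only: cf_determinant)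
  then show ?thesis by simp
qed

lemma coprime_cf_num_cf_den: "coprime (int (cf_num b n)) (int (cf_den b n))"
proof (rule coprimeI)
  fix d assume "d dvd int (cf_num b n)" "d dvd int (cf_den b n)"
  then have "d dvd (-1) ^ n"
    unfolding cf_determinant[of b n, symmetric] by (intro dvd_diff dvd_mult dvd_mult2)
  moreover have "is_unit ((-1 :: int) ^ n)"
    by (cases "even n") simp_all
  ultimately show "is_unit d"
    by (rule dvd_unit_imp_unit)
qed

context
  fixes b :: "nat \<Rightarrow> nat"
  assumes b: "partial_quotients b"
begin

lemma partial_quotient_pos: "b (Suc n) > 0"
  using b by (simp add: partial_quotients_def)

lemma cf_den_pos: "cf_den b n > 0"
  using b by (induction b n rule: cf_den.induct) (simp_all add: partial_quotients_def)

lemma cf_den_Suc_ge: "b (Suc n) * cf_den b n \<le> cf_den b (Suc n)"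
  by (cases n) simp_all

lemma cf_den_Suc_le: "cf_den b (Suc n) \<le> (b (Suc n) + 1) * cf_den b n"
proof (cases n)
  case (Suc m)
  have "cf_den b m \<le> b (Suc m) * cf_den b m"
    using partial_quotient_pos[of m] by simp
  also have "\<dots> \<le> cf_den b (Suc m)"
    by (rule cf_den_Suc_ge)
  finally show ?thesis
    using Suc by simp
qed simp

lemma cf_den_le_Suc: "cf_den b n \<le> cf_den b (Suc n)"
proof -
  have "cf_den b n \<le> b (Suc n) * cf_den b n"
    using partial_quotient_pos[of n] by simp
  then show ?thesis
    using cf_den_Suc_ge[of n] by linarith
qed

lemma mono_cf_den: "mono (cf_den b)"
  using cf_den_le_Suc by (simp add: mono_iff_le_Suc)

lemma cf_den_ge: "n \<le> cf_den b n"
proof (induction n)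
  case (Suc n)
  show ?case
  \<comment> \<open>q_0 = q_1 = 1 is possible, so strict growth is available only from q_1
    onwards.\<close>
  proof (cases n)
    case 0
    then show ?thesis using cf_den_pos[of 1] by simp
  next
    case (Suc m)
    have "cf_den b (Suc m) \<le> b (Suc (Suc m)) * cf_den b (Suc m)"
      using partial_quotient_pos[of "Suc m"] by simp
    also have "\<dots> < cf_den b (Suc n)"
      using Suc cf_den_pos[of m] by simp
    finally show ?thesis
      using Suc \<open>n \<le> cf_den b n\<close> by simp
  qed
qed simp

lemma filterlim_cf_den: "filterlim (cf_den b) at_top sequentially"
  by (rule filterlim_at_top_mono[OF filterlim_ident]) (simp add: cf_den_ge)

text \<open>Replacing the final \<open>0\<close> of a finite continued fraction by a tail \<open>t\<close> makes the recurrence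
  for the convergents provable by induction on their length.\<close>

lemma foldr_cf:
  assumes "t \<ge> (0::rat)"
  shows "foldr (\<lambda>a x. 1 / (of_nat a + x)) (map b [1..<Suc (Suc n)]) t =
    (of_nat (cf_num b (Suc n)) + t * of_nat (cf_num b n)) /
    (of_nat (cf_den b (Suc n)) + t * of_nat (cf_den b n))"
  using assms
proof (induction n arbitrary: t)
  case 0
  then show ?case by simp
next
  case (Suc n)
  define c where "c = (of_nat (b (Suc (Suc n))) + t :: rat)"
  have "of_nat (b (Suc (Suc n))) > (0::rat)"
    using partial_quotient_pos[of "Suc n"] by simp
  then have c: "c > 0"
    using Suc.prems unfolding c_def by linarith
  \<comment> \<open>The last partial quotient is absorbed into the tail, which changes from
    \<open>t\<close> to \<open>1 / c\<close>; the list is then shorter by one.\<close>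
  have "foldr (\<lambda>a x. 1 / (of_nat a + x)) (map b [1..<Suc (Suc (Suc n))]) t
      = foldr (\<lambda>a x. 1 / (of_nat a + x)) (map b [1..<Suc (Suc n)]) (1 / c)"
    unfolding upt_Suc_append[OF le_SucI[OF le_SucI[OF order_refl]], of 1] c_def by simp
  also have "\<dots> = (of_nat (cf_num b (Suc n)) + 1 / c * of_nat (cf_num b n)) /
      (of_nat (cf_den b (Suc n)) + 1 / c * of_nat (cf_den b n))"
    using c by (intro Suc.IH) simp
  also have "\<dots> = (c * (of_nat (cf_num b (Suc n)) + 1 / c * of_nat (cf_num b n))) /
      (c * (of_nat (cf_den b (Suc n)) + 1 / c * of_nat (cf_den b n)))"
    using c by simp
  also have "\<dots> = (c * of_nat (cf_num b (Suc n)) + of_nat (cf_num b n)) /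
      (c * of_nat (cf_den b (Suc n)) + of_nat (cf_den b n))"
    using c by (simp add: distrib_left)
  finally show ?case
    by (simp add: c_def algebra_simps)
qed

lemma convergent_cf_eq: "convergent_cf b n = of_nat (cf_num b n) / of_nat (cf_den b n)"
proof (cases n)
  case 0
  then show ?thesis by (simp add: convergent_cf_def)
next
  case (Suc m)
  have "finite_cf xs = foldr (\<lambda>a x. 1 / (of_nat a + x)) xs 0" for xs
    by (induction xs) simp_all
  then show ?thesis
    using foldr_cf[of 0 m] Suc by (simp add: convergent_cf_def)
qed

text \<open>The recurrence yields coprime pairs with positive denominator, and
  \<open>quotient_of\<close> returns the unique such pair.\<close>

lemma cf_denom_eq: "cf_denom b n = int (cf_den b n)"
proof -
  have "quotient_of (convergent_cf b n) = (int (cf_num b n), int (cf_den b n))"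
    using cf_den_pos[of n] coprime_cf_num_cf_den[of b n] quotient_of_Fract[of "int (cf_num b n)" "int (cf_den b n)"]
    by (simp add: convergent_cf_eq Fract_of_int_quotient normalize_stable)
  then show ?thesis
    by (simp add: cf_denom_def)
qed

section \<open>The value of a continued fraction\<close>

text \<open>Consecutive convergents differ by the determinant over the product of their
  denominators, so they telescope to an alternating series.\<close>

lemma convergent_cf_sum:
  "real (cf_num b n) / real (cf_den b n) =
    (\<Sum>i<n. (-1) ^ i * (1 / (real (cf_den b i) * real (cf_den b (Suc i)))))"
proof (induction n)
  case (Suc n)
  have "real (cf_num b (Suc n)) / real (cf_den b (Suc n)) - real (cf_num b n) / real (cf_den b n)
      = (real (cf_num b (Suc n)) * real (cf_den b n) - real (cf_num b n) * real (cf_den b (Suc n)))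
        / (real (cf_den b n) * real (cf_den b (Suc n)))"
    using cf_den_pos[of n] cf_den_pos[of "Suc n"] by (simp add: field_simps)
  then show ?case
    unfolding cf_determinant_real using Suc by simp
qed simp

text \<open>Leibniz criterion: the terms of the alternating series decrease to 0, so the even
  partial sums lie below the limit and the odd ones above.\<close>

lemma cf_value_alternates: "(-1) ^ n * (cf_value b - real (cf_num b n) / real (cf_den b n)) \<ge> 0"
proof -
  define a where "a i = 1 / (real (cf_den b i) * real (cf_den b (Suc i)))" for i
  have top: "filterlim (\<lambda>i. real (cf_den b i)) at_top sequentially"
    by (rule filterlim_compose[OF filterlim_real_sequentially filterlim_cf_den])
  have "filterlim (\<lambda>i. real (cf_den b (Suc i))) at_top sequentially"
    using top by (rule filterlim_compose[OF _ filterlim_Suc])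
  with top have "a \<longlonglongrightarrow> 0"
    unfolding a_def by (intro tendsto_divide_0[OF tendsto_const] filterlim_at_top_imp_at_infinity
        filterlim_at_top_mult_at_top)
  moreover have "a (Suc i) \<le> a i" for i
  proof -
    have "real (cf_den b i) \<le> real (cf_den b (Suc i))" "real (cf_den b (Suc i)) \<le> real (cf_den b (Suc (Suc i)))"
      using cf_den_le_Suc by (simp_all del: cf_den.simps)
    moreover have "real (cf_den b i) > 0" "real (cf_den b (Suc i)) > 0"
      using cf_den_pos by (simp_all del: cf_den.simps)
    ultimately show ?thesis
      unfolding a_def by (intro divide_left_mono mult_mono mult_pos_pos) linarith+
  qed
  then have "monoseq a"
    by (intro monoI2) (simp add: decseq_SucI decseqD)
  \<comment> \<open>The sign of the first term decides which partial sums are the lower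
    ones.\<close>
  moreover have "a 0 > 0"
    using cf_den_pos[of 0] cf_den_pos[of 1] by (simp add: a_def)
  ultimately have leibniz: "summable (\<lambda>i. (-1) ^ i * a i)"
    "\<forall>n. (\<Sum>i. (-1) ^ i * a i) \<in> {\<Sum>i<2*n. (-1) ^ i * a i..\<Sum>i<2*n+1. (-1) ^ i * a i}"
    using summable_Leibniz[of a] by blast+
  have conv: "real_of_rat (convergent_cf b n) = (\<Sum>i<n. (-1) ^ i * a i)" for n
    by (simp add: convergent_cf_eq convergent_cf_sum of_rat_divide a_def)
  \<comment> \<open>Convergence is what makes \<open>lim\<close> in \<open>cf_value\<close> denote
    the actual limit.\<close>
  have "(\<lambda>n. real_of_rat (convergent_cf b n)) \<longlonglongrightarrow> (\<Sum>i. (-1) ^ i * a i)"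
    unfolding conv using leibniz(1) by (rule summable_LIMSEQ)
  then have val: "cf_value b = (\<Sum>i. (-1) ^ i * a i)"
    unfolding cf_value_def by (rule limI)
  have sum: "real (cf_num b n) / real (cf_den b n) = (\<Sum>i<n. (-1) ^ i * a i)" for n
    by (simp add: convergent_cf_sum a_def)
  show ?thesis
  proof (cases "even n")
    case True
    then obtain m where "n = 2 * m" by blast
    then show ?thesis using leibniz(2)[rule_format, of m] unfolding val sum by simp
  next
    case False
    then obtain m where "n = 2 * m + 1" by (rule oddE)
    then show ?thesis using leibniz(2)[rule_format, of m] unfolding val sum by simp
  qed
qed

section \<open>Errors of the convergents and best approximation\<close>

text \<open>This is \<bar>q_n \<theta> - p_n\<bar>; the explicit sign in place of the absolute value
  keeps the identities below linear.\<close>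

definition cf_error :: "nat \<Rightarrow> real" where
  "cf_error n = (-1) ^ n * (real (cf_den b n) * cf_value b - real (cf_num b n))"

lemma cf_error_nonneg: "cf_error n \<ge> 0"
proof -
  have "cf_error n = real (cf_den b n) * ((-1) ^ n * (cf_value b - real (cf_num b n) / real (cf_den b n)))"
    using cf_den_pos[of n] by (simp add: cf_error_def field_simps)
  then show ?thesis
    using cf_value_alternates[of n] by simp
qed

text \<open>In this combination \<theta> cancels and the determinant of consecutive convergents
  remains.\<close>

lemma cf_error_cross:
  "real (cf_den b (Suc n)) * cf_error n + real (cf_den b n) * cf_error (Suc n) = 1"
proof -
  have "real (cf_den b (Suc n)) * cf_error n + real (cf_den b n) * cf_error (Suc n)
      = (-1) ^ n * (real (cf_num b (Suc n)) * real (cf_den b n) - real (cf_num b n) * real (cf_den b (Suc n)))"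
    by (simp add: cf_error_def algebra_simps)
  then show ?thesis
    unfolding cf_determinant_real by (simp flip: power_mult_distrib)
qed

text \<open>The errors satisfy the recurrence read backwards, with nonnegative terms and a
  coefficient of at least 1.\<close>

lemma cf_error_Suc_le: "cf_error (Suc n) \<le> cf_error n"
proof -
  have "cf_error n = real (b (Suc (Suc n))) * cf_error (Suc n) + cf_error (Suc (Suc n))"
    by (simp add: cf_error_def algebra_simps)
  moreover have "1 * cf_error (Suc n) \<le> real (b (Suc (Suc n))) * cf_error (Suc n)"
    using partial_quotient_pos[of "Suc n"] by (intro mult_right_mono cf_error_nonneg) simp
  ultimately show ?thesis
    using cf_error_nonneg[of "Suc (Suc n)"] by linarith
qed

text \<open>Dropping the second summand of \<open>cf_error_cross\<close> gives this bound; enlarging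
  it by \<open>cf_error_Suc_le\<close> gives the next one.\<close>

lemma cf_error_upper: "cf_error n \<le> 1 / real (cf_den b (Suc n))"
proof -
  have "real (cf_den b n) * cf_error (Suc n) \<ge> 0"
    by (simp add: cf_error_nonneg)
  then have "real (cf_den b (Suc n)) * cf_error n \<le> 1"
    using cf_error_cross[of n] by linarith
  then show ?thesis
    using cf_den_pos[of "Suc n"] by (simp add: field_simps)
qed

lemma cf_error_lower: "cf_error n \<ge> 1 / (real (cf_den b n) + real (cf_den b (Suc n)))"
proof -
  have "real (cf_den b n) * cf_error (Suc n) \<le> real (cf_den b n) * cf_error n"
    by (intro mult_left_mono cf_error_Suc_le) simp
  then have "1 \<le> (real (cf_den b n) + real (cf_den b (Suc n))) * cf_error n"
    using cf_error_cross[of n] by (simp add: algebra_simps)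
  then show ?thesis
    using cf_den_pos[of n] by (simp add: field_simps)
qed

text \<open>Two consecutive convergents form a basis of the integer lattice. The bound on q forces
  coordinates of opposite sign (or y = 0), and since the errors alternate in sign, the two
  contributions add up instead of cancelling.\<close>

lemma best_approximation:
  fixes p q :: int
  assumes q: "0 < q" "q < int (cf_den b (Suc n))"
  shows "\<bar>of_int q * cf_value b - of_int p\<bar> \<ge> cf_error n"
proof -
  define P Q P' Q' where "P = int (cf_num b n)" and "Q = int (cf_den b n)"
    and "P' = int (cf_num b (Suc n))" and "Q' = int (cf_den b (Suc n))"
  define s :: int where "s = (-1) ^ n"
  have det: "P' * Q - P * Q' = s" and ss: "s * s = 1"
    unfolding P_def Q_def P'_def Q'_def s_def
    by (simp_all add: cf_determinant flip: power_mult_distrib)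
  have Q: "Q > 0" "Q' > 0"
    unfolding Q_def Q'_def using cf_den_pos by simp_all
  text \<open>The coordinates of \<open>(p, q)\<close> in the basis formed by two consecutive convergents.\<close>
  define x y where "x = s * (P' * q - Q' * p)" and "y = s * (Q * p - P * q)"
  have "x * Q + y * Q' = s * (P' * Q - P * Q') * q" "x * P + y * P' = s * (P' * Q - P * Q') * p"
    by (simp_all add: x_def y_def algebra_simps)
  then have xq: "x * Q + y * Q' = q" and xp: "x * P + y * P' = p"
    by (simp_all add: det ss)
  \<comment> \<open>If y > 0, then y Q' already exceeds q, so x must be negative; if y < 0, then x
    must be positive to keep q positive.\<close>
  have opposite: "x \<noteq> 0 \<and> x * y \<le> 0"
  proof (cases "y = 0")
    case True
    then show ?thesis using xq q by auto
  next
    case False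
    show ?thesis
    proof (cases "y > 0")
      case True
      then have "y * Q' \<ge> Q'" using Q by simp
      then have "x * Q < 0" using xq q unfolding Q'_def by linarith
      then have "x < 0" using Q by (simp add: mult_less_0_iff)
      then show ?thesis using True by (simp add: mult_le_0_iff)
    next
      case F: False
      then have "y * Q' < 0" using False Q by (simp add: mult_less_0_iff)
      then have "x * Q > 0" using xq q by linarith
      then have "x > 0" using Q by (simp add: zero_less_mult_iff)
      then show ?thesis using F by (simp add: mult_le_0_iff)
    qed
  qed
  \<comment> \<open>The alternating sign in \<open>cf_error\<close> turns the sum into a difference,
    whose two terms do not cancel by \<open>opposite\<close>.\<close>
  have "of_int q * cf_value b - of_int p
      = of_int s * (of_int x * cf_error n - of_int y * cf_error (Suc n))"
  proof -
    have "real_of_int s * cf_error n = of_int Q * cf_value b - of_int P"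
      "- real_of_int s * cf_error (Suc n) = of_int Q' * cf_value b - of_int P'"
      by (simp_all add: cf_error_def s_def P_def Q_def P'_def Q'_def flip: mult.assoc power_mult_distrib)
    then have "of_int s * (of_int x * cf_error n - of_int y * cf_error (Suc n))
      = of_int x * (of_int Q * cf_value b - of_int P) + of_int y * (of_int Q' * cf_value b - of_int P')"
      by (metis (no_types, opaque_lifting) add_uminus_conv_diff mult.left_commute mult_minus_left
          mult_minus_right right_diff_distrib)
    also have "\<dots> = of_int (x * Q + y * Q') * cf_value b - of_int (x * P + y * P')"
      by (simp add: algebra_simps)
    finally show ?thesis
      unfolding xq xp ..
  qed
  moreover have "\<bar>real_of_int s\<bar> = 1"
    by (simp add: s_def power_abs)
  ultimately have "\<bar>of_int q * cf_value b - of_int p\<bar> = \<bar>of_int x * cf_error n - of_int y * cf_error (Suc n)\<bar>"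
    by (simp add: abs_mult)
  also have "\<dots> \<ge> cf_error n"
  proof (cases "x > 0")
    case True
    then have "1 * cf_error n \<le> of_int x * cf_error n"
      by (intro mult_right_mono cf_error_nonneg) simp
    moreover have "of_int y * cf_error (Suc n) \<le> 0"
      using True opposite cf_error_nonneg[of "Suc n"] by (simp add: mult_le_0_iff)
    ultimately show ?thesis by linarith
  next
    case False
    then have "of_int x * cf_error n \<le> (-1) * cf_error n"
      using opposite by (intro mult_right_mono cf_error_nonneg) linarith
    moreover have "of_int y * cf_error (Suc n) \<ge> 0"
      using False opposite cf_error_nonneg[of "Suc n"] by (auto simp: mult_le_0_iff)
    ultimately show ?thesis by linarith
  qed
  finally show ?thesis .
qed

section \<open>Consequences of the growth condition\<close>

text \<open>The convergents are the witnesses: q_(n+1) is at least b_(n+1) q_n, which exceeds 1 /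
  (\<omega>(q_n) q_n).\<close>

lemma approximable_cf_value:
  assumes "growth_condition \<omega> b"
  shows "approximable_to_order (cf_value b) \<omega>"
  unfolding approximable_to_order_def
proof (intro allI impI)
  fix C :: real
  have "\<exists>n. real (cf_den b n) > C"
    by (metis cf_den_ge of_nat_mono order_less_le_trans reals_Archimedean2)
  then obtain n where n: "real (cf_den b n) > C" ..
  define Q B where "Q = real (cf_den b n)" and "B = real (b (Suc n))"
  have Q: "Q > 0" and B: "B > 0"
    using cf_den_pos[of n] partial_quotient_pos[of n] by (simp_all add: Q_def B_def)
  have "B * \<omega> Q * Q\<^sup>2 > 1"
    using assms by (simp add: growth_condition_def cf_denom_eq Q_def B_def)
  then have \<omega>: "1 / (B * Q) / Q < \<omega> Q"
    using Q B by (simp add: field_simps power2_eq_square)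
  have "real (b (Suc n) * cf_den b n) \<le> real (cf_den b (Suc n))"
    by (rule of_nat_mono) (rule cf_den_Suc_ge)
  then have BQ: "B * Q \<le> real (cf_den b (Suc n))"
    by (simp add: B_def Q_def)
  have "\<bar>cf_value b - real (cf_num b n) / Q\<bar> = cf_error n / Q"
  proof -
    have "cf_value b - real (cf_num b n) / Q = (Q * cf_value b - real (cf_num b n)) / Q"
      using Q by (simp add: diff_divide_distrib)
    moreover have "\<bar>Q * cf_value b - real (cf_num b n)\<bar> = \<bar>cf_error n\<bar>"
      by (simp add: cf_error_def Q_def abs_mult power_abs)
    ultimately show ?thesis
      using Q cf_error_nonneg[of n] by simp
  qed
  also have "\<dots> \<le> 1 / real (cf_den b (Suc n)) / Q"
    using Q by (intro divide_right_mono cf_error_upper) simp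
  also have "\<dots> \<le> 1 / (B * Q) / Q"
    using Q B BQ by (intro divide_right_mono divide_left_mono) (simp_all add: cf_den_pos)
  also note \<omega>
  finally show "\<exists>p q :: int. of_int q > C \<and> \<bar>cf_value b - of_int p / of_int q\<bar> < \<omega> (of_int q)"
    using n by (intro exI[of _ "int (cf_num b n)"] exI[of _ "int (cf_den b n)"]) (simp add: Q_def)
qed

text \<open>The witness \<open>k\<close> is the denominator q_n with q_n \<le> q < q_(n+1). Leaving
  it existential serves both choices of \<omega>, which then compare \<open>k\<close> with
  \<open>q\<close> in their own way.\<close>

lemma approximation_lower_bound:
  assumes "growth_condition \<omega> b"
  obtains N :: int where "N > 0"
    "\<And>p q :: int. q \<ge> N \<Longrightarrow> \<exists>k::nat. k > 0 \<and> int k \<le> q \<and>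
      \<bar>cf_value b - of_int p / of_int q\<bar> \<ge> \<omega> (real k) * real k / (6 * of_int q)"
proof -
  let ?g = "\<lambda>n. real (b (Suc n)) * \<omega> (real (cf_den b n)) * (real (cf_den b n))\<^sup>2"
  have g1: "?g n > 1" for n
    using assms by (simp add: growth_condition_def cf_denom_eq)
  have "?g \<longlonglongrightarrow> 1"
    using assms by (simp add: growth_condition_def cf_denom_eq)
  then have "eventually (\<lambda>n. ?g n < 2) sequentially"
    by (rule order_tendstoD) simp
  then obtain n0 where n0: "\<And>n. n \<ge> n0 \<Longrightarrow> ?g n < 2"
    by (auto simp: eventually_sequentially)
  show thesis
  proof
    show "int (cf_den b n0) > 0"
      using cf_den_pos by simp
  next
    fix p q :: int
    assume q: "q \<ge> int (cf_den b n0)"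
    have q0: "q > 0"
      using q cf_den_pos[of n0] by linarith
    \<comment> \<open>\<open>m\<close> is the first index whose denominator exceeds q; it lies
      beyond \<open>n0\<close>, so it has a predecessor n, where the bound \<open>?g n < 2\<close>
      holds.\<close>
    define m where "m = (LEAST m. q < int (cf_den b m))"
    have "q < int (cf_den b (Suc (nat q)))"
      using cf_den_ge[of "Suc (nat q)"] by linarith
    then have m: "q < int (cf_den b m)" and least: "\<And>k. k < m \<Longrightarrow> int (cf_den b k) \<le> q"
      unfolding m_def by (rule LeastI, use not_less_Least in fastforce)
    have "m > n0"
    proof (rule ccontr)
      assume "\<not> m > n0"
      then have "cf_den b m \<le> cf_den b n0"
        by (intro monoD[OF mono_cf_den]) simp
      then show False using m q by linarith
    qed
    then obtain n where n: "m = Suc n" "n \<ge> n0"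
      by (cases m) auto
    define Q B where "Q = real (cf_den b n)" and "B = real (b (Suc n))"
    have Q: "Q > 0" and B: "B \<ge> 1"
      using cf_den_pos[of n] partial_quotient_pos[of n] by (simp_all add: Q_def B_def)
    have g: "B * \<omega> Q * Q\<^sup>2 > 1" "B * \<omega> Q * Q\<^sup>2 < 2"
      using g1[of n] n0[OF n(2)] by (simp_all add: Q_def B_def)
    \<comment> \<open>Positivity of \<omega> at this denominator is read off from the growth
      condition.\<close>
    have "\<omega> Q > 0"
    proof (rule ccontr)
      assume "\<not> \<omega> Q > 0"
      then have "B * \<omega> Q * Q\<^sup>2 \<le> 0"
        using B by (intro mult_nonpos_nonneg mult_nonneg_nonpos) simp_all
      then show False using g by linarith
    qed
    \<comment> \<open>Origin of the 6: q_n + q_(n+1) is at most (B + 2) Q, hence at most 3 B Q, and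
      B \<omega>(Q) \<open>Q\<^sup>2\<close> is below 2.\<close>
    have "real (cf_den b (Suc n)) \<le> real ((b (Suc n) + 1) * cf_den b n)"
      by (rule of_nat_mono) (rule cf_den_Suc_le)
    then have "Q + real (cf_den b (Suc n)) \<le> B * Q + 2 * Q"
      by (simp add: Q_def B_def algebra_simps)
    also have "2 * Q \<le> 2 * (B * Q)"
      using B Q by simp
    finally have "Q + real (cf_den b (Suc n)) \<le> 3 * B * Q" by simp
    then have "\<omega> Q * Q * (Q + real (cf_den b (Suc n))) \<le> \<omega> Q * Q * (3 * B * Q)"
      using \<open>\<omega> Q > 0\<close> Q by (intro mult_left_mono) simp_all
    also have "\<dots> \<le> 6"
      using g(2) by (simp add: power2_eq_square mult_ac)
    finally have "\<omega> Q * Q / 6 \<le> 1 / (Q + real (cf_den b (Suc n)))"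
      using Q by (simp add: field_simps)
    also have "\<dots> \<le> cf_error n"
      unfolding Q_def by (rule cf_error_lower)
    also have "\<dots> \<le> \<bar>of_int q * cf_value b - of_int p\<bar>"
      using q0 m n by (intro best_approximation) simp_all
    finally have "\<omega> Q * Q / 6 / of_int q \<le> \<bar>of_int q * cf_value b - of_int p\<bar> / of_int q"
      using q0 by (intro divide_right_mono) simp_all
    also have "\<dots> = \<bar>of_int q * cf_value b - of_int p\<bar> / \<bar>of_int q\<bar>"
      using q0 by simp
    also have "\<dots> = \<bar>cf_value b - of_int p / of_int q\<bar>"
      using q0 unfolding abs_divide[symmetric] by (simp add: diff_divide_distrib)
    finally have "\<omega> Q * Q / (6 * of_int q) \<le> \<bar>cf_value b - of_int p / of_int q\<bar>"
      by simp
    then show "\<exists>k::nat. k > 0 \<and> int k \<le> q \<and>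
        \<bar>cf_value b - of_int p / of_int q\<bar> \<ge> \<omega> (real k) * real k / (6 * of_int q)"
      using cf_den_pos[of n] least[of n] n by (intro exI[of _ "cf_den b n"]) (simp add: Q_def)
  qed
qed

end

section \<open>Existence of suitable partial quotients\<close>

text \<open>Each b_(n+1) is the least integer above 1 / (\<omega>(q_n) \<open>q_n\<^sup>2\<close>).
  It overshoots by at most 1, so the product in the growth condition exceeds 1 by at most
  \<omega>(q_n) \<open>q_n\<^sup>2\<close>, which tends to 0.\<close>

lemma greedy_partial_quotients:
  assumes pos: "\<And>n::nat. n > 0 \<Longrightarrow> \<omega> (real n) > 0"
    and lim: "(\<lambda>n. \<omega> (real n) * (real n)\<^sup>2) \<longlonglongrightarrow> 0"
  obtains b where "partial_quotients b" "growth_condition \<omega> b"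
proof -
  define f where "f q = nat \<lfloor>1 / (\<omega> (real q) * (real q)\<^sup>2)\<rfloor> + 1" for q
  \<comment> \<open>b_(n+1) depends on q_n, which depends on the earlier partial quotients.
    Iterating the pair (q_n, q_(n-1)), with 0 for q_(-1), breaks this circle.\<close>
  define d where "d = rec_nat (1, 0) (\<lambda>_ (q, q'). (f q * q + q', q))"
  define b where "b n = f (fst (d (n - 1)))" for n
  have b: "partial_quotients b"
    by (simp add: partial_quotients_def b_def f_def)
  have d0: "d 0 = (1, 0)" and dS: "d (Suc n) = (f (fst (d n)) * fst (d n) + snd (d n), fst (d n))" for n
    by (simp_all add: d_def split_beta)
  have den: "fst (d n) = cf_den b n" for n
  proof (induction n rule: less_induct)
    case (less n)
    show ?case
      using less[of "n - 1"] less[of "n - 2"]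
      by (cases "(b, n)" rule: cf_den.cases) (simp_all add: d0 dS b_def[of "Suc n" for n])
  qed
  have step: "b (Suc n) = f (cf_den b n)" for n
    by (simp add: b_def den)
  let ?w = "\<lambda>n. \<omega> (real (cf_den b n)) * (real (cf_den b n))\<^sup>2"
  have w: "?w n > 0" for n
    using pos cf_den_pos[OF b, of n] by simp
  have lower: "real (b (Suc n)) * \<omega> (real (cf_den b n)) * (real (cf_den b n))\<^sup>2 > 1" for n
  proof -
    have "1 / ?w n < real (b (Suc n))"
      unfolding step f_def by linarith
    then show ?thesis
      using w[of n] by (simp add: field_simps)
  qed
  have upper: "real (b (Suc n)) * \<omega> (real (cf_den b n)) * (real (cf_den b n))\<^sup>2 \<le> 1 + ?w n" for n
  proof -
    have "1 / ?w n \<ge> 0"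
      using w[of n] by simp
    then have "real (b (Suc n)) \<le> 1 / ?w n + 1"
      unfolding step f_def by linarith
    then have "real (b (Suc n)) * ?w n \<le> (1 / ?w n + 1) * ?w n"
      using w[of n] by (intro mult_right_mono) simp_all
    also have "\<dots> = 1 + ?w n"
      using less_imp_neq[OF w[of n]] by (simp only: distrib_right) simp
    finally show ?thesis
      by (simp add: mult.assoc)
  qed
  have "?w \<longlonglongrightarrow> 0"
    using filterlim_compose[OF lim filterlim_cf_den[OF b]] .
  then have "(\<lambda>n. 1 + ?w n) \<longlonglongrightarrow> 1"
    using tendsto_add[OF tendsto_const[of 1]] by fastforce
  then have "(\<lambda>n. real (b (Suc n)) * \<omega> (real (cf_den b n)) * (real (cf_den b n))\<^sup>2) \<longlonglongrightarrow> 1"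
    by (rule tendsto_sandwich[OF always_eventually[OF allI[OF less_imp_le[OF lower]]]
          always_eventually[OF allI[OF upper]] tendsto_const])
  then have "growth_condition \<omega> b"
    using lower by (simp add: growth_condition_def cf_denom_eq[OF b])
  with b show thesis
    by (rule that)
qed

section \<open>Irrationality measures\<close>

text \<open>Unreduced fractions supply the large denominators; hence no bound of either kind can
  hold at a rational number.\<close>

lemma rational_equals_large_fraction:
  fixes \<theta> :: real and Q :: int
  assumes "\<theta> \<in> \<rat>"
  obtains p q :: int where "q \<ge> Q" "\<theta> = of_int p / of_int q"
proof -
  obtain a c :: int where c: "c > 0" "\<theta> = of_int a / of_int c"
    using assms by (metis Rats_cases')
  define k where "k = \<bar>Q\<bar> + 1"
  have "k > 0"
    by (simp add: k_def)
  then have "k * 1 \<le> k * c"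
    using c by (intro mult_left_mono) simp_all
  moreover have "\<theta> = of_int (k * a) / of_int (k * c)"
    using c \<open>k > 0\<close> by simp
  moreover have "k > Q"
    by (simp add: k_def)
  ultimately show thesis
    using that[of "k * c" "k * a"] by linarith
qed

text \<open>Already for \<epsilon> = 1, a fraction equal to \<theta> would need its error 0 to
  exceed a nonnegative number.\<close>

lemma exponent_bound_irrational:
  assumes "exponent_bound \<theta> m"
  shows "\<theta> \<notin> \<rat>"
proof
  assume "\<theta> \<in> \<rat>"
  obtain Q :: int where "\<And>p q::int. q \<ge> Q \<Longrightarrow> \<bar>\<theta> - of_int p / of_int q\<bar> > of_int q powr (-(m + 1))"
    using assms unfolding exponent_bound_def by (meson zero_less_one)
  moreover obtain p q :: int where "q \<ge> Q" "\<theta> = of_int p / of_int q"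
    using rational_equals_large_fraction[OF \<open>\<theta> \<in> \<rat>\<close>] .
  ultimately show False
    by (metis abs_zero diff_self not_less powr_ge_zero)
qed

lemma base_bound_irrational:
  assumes "base_bound \<theta> \<beta>"
  shows "\<theta> \<notin> \<rat>"
proof
  assume "\<theta> \<in> \<rat>"
  have "\<beta> \<ge> 1"
    using assms by (simp add: base_bound_def)
  obtain Q :: int where "\<And>p q::int. q \<ge> Q \<Longrightarrow> \<bar>\<theta> - of_int p / of_int q\<bar> > 1 / (\<beta> + 1) powi q"
    using assms unfolding base_bound_def by (meson zero_less_one)
  moreover obtain p q :: int where "q \<ge> Q" "\<theta> = of_int p / of_int q"
    using rational_equals_large_fraction[OF \<open>\<theta> \<in> \<rat>\<close>] .
  ultimately have "1 / (\<beta> + 1) powi q < 0"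
    by (metis abs_zero diff_self)
  moreover have "(\<beta> + 1) powi q > 0"
    using \<open>\<beta> \<ge> 1\<close> by (intro zero_less_power_int) simp
  ultimately show False
    by (simp add: field_simps)
qed

text \<open>A bound m < \<mu>, taken with \<epsilon> = \<mu> - m, would contradict approximability
  to order \<open>x powr (-\<mu>)\<close>.\<close>

lemma irrationality_exponent_eqI:
  assumes bound: "exponent_bound \<theta> \<mu>" and appr: "approximable_to_order \<theta> (\<lambda>x. x powr (-\<mu>))"
  shows "irrationality_exponent \<theta> = ereal \<mu>"
proof -
  have least: "\<mu> \<le> m" if "exponent_bound \<theta> m" for m
  proof (rule ccontr)
    assume "\<not> \<mu> \<le> m"
    then have "\<mu> - m > 0" by simp
    then obtain Q :: int where Q: "Q > 0"
      "\<And>p q::int. q \<ge> Q \<Longrightarrow> \<bar>\<theta> - of_int p / of_int q\<bar> > of_int q powr (-(m + (\<mu> - m)))"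
      using \<open>exponent_bound \<theta> m\<close> unfolding exponent_bound_def by blast
    then obtain p q :: int where "real_of_int q > of_int Q" "\<bar>\<theta> - of_int p / of_int q\<bar> < of_int q powr (-\<mu>)"
      using appr unfolding approximable_to_order_def by (meson of_int_0_less_iff)
    then show False
      using Q(2)[of q p] by simp
  qed
  then have "(LEAST m. exponent_bound \<theta> m) = \<mu>"
    using bound by (intro Least_equality)
  then show ?thesis
    using bound least unfolding irrationality_exponent_def by auto
qed

lemma irrationality_base_eqI:
  assumes bound: "base_bound \<theta> \<beta>" and appr: "approximable_to_order \<theta> (\<lambda>x. \<beta> powr (-x))"
  shows "irrationality_base \<theta> = ereal \<beta>"
proof -
  have "\<beta> > 0"
    using bound by (simp add: base_bound_def)
  have least: "\<beta> \<le> m" if "base_bound \<theta> m" for m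
  proof (rule ccontr)
    assume "\<not> \<beta> \<le> m"
    \<comment> \<open>With \<epsilon> = \<beta> - m the assumed bound becomes exactly the order of
      approximation.\<close>
    then have "\<beta> - m > 0" by simp
    then obtain Q :: int where Q: "Q > 0"
      "\<And>p q::int. q \<ge> Q \<Longrightarrow> \<bar>\<theta> - of_int p / of_int q\<bar> > 1 / (m + (\<beta> - m)) powi q"
      using \<open>base_bound \<theta> m\<close> unfolding base_bound_def by blast
    then obtain p q :: int where "real_of_int q > of_int Q" "\<bar>\<theta> - of_int p / of_int q\<bar> < \<beta> powr (- of_int q)"
      using appr unfolding approximable_to_order_def by (meson of_int_0_less_iff)
    then show False
      using Q(2)[of q p] \<open>\<beta> > 0\<close> by (simp add: powr_minus_divide powr_real_of_int')
  qed
  then have "(LEAST m. base_bound \<theta> m) = \<beta>"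
    using bound by (intro Least_equality)
  then show ?thesis
    using bound least unfolding irrationality_base_def by auto
qed

lemma exponent_bound_cf_value:
  assumes b: "partial_quotients b" and growth: "growth_condition (\<lambda>x. x powr (-\<mu>)) b" and \<mu>: "\<mu> \<ge> 1"
  shows "exponent_bound (cf_value b) \<mu>"
  unfolding exponent_bound_def
proof (intro conjI allI impI)
  fix \<epsilon> :: real assume \<epsilon>: "\<epsilon> > 0"
  obtain N :: int where N: "N > 0"
    "\<And>p q :: int. q \<ge> N \<Longrightarrow> \<exists>k::nat. k > 0 \<and> int k \<le> q \<and>
      \<bar>cf_value b - of_int p / of_int q\<bar> \<ge> real k powr (-\<mu>) * real k / (6 * of_int q)"
    using approximation_lower_bound[OF b growth] by blast
  \<comment> \<open>From \<open>M\<close> on, \<open>q powr \<epsilon>\<close> exceeds 6 and absorbs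
    the constant.\<close>
  obtain M :: int where M: "of_int M > (6::real) powr (1 / \<epsilon>)"
    using ex_less_of_int by blast
  show "\<exists>Q::int. Q > 0 \<and> (\<forall>p q::int. q \<ge> Q \<longrightarrow>
      \<bar>cf_value b - of_int p / of_int q\<bar> > of_int q powr (-(\<mu> + \<epsilon>)))"
  proof (intro exI[of _ "max N M"] conjI allI impI)
    show "max N M > 0" using N by simp
    fix p q :: int assume q: "q \<ge> max N M"
    then obtain k :: nat where k: "k > 0" "int k \<le> q"
      "\<bar>cf_value b - of_int p / of_int q\<bar> \<ge> real k powr (-\<mu>) * real k / (6 * of_int q)"
      using N(2)[of q p] by auto
    define x where "x = real_of_int q"
    have x: "x > 0" "real k \<le> x"
      using k unfolding x_def by (linarith, metis of_int_le_iff of_int_of_nat_eq)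
    have "x > 6 powr (1 / \<epsilon>)"
      using M q unfolding x_def by (smt (verit) max.bounded_iff of_int_le_iff)
    then have "x powr \<epsilon> > (6 powr (1 / \<epsilon>)) powr \<epsilon>"
      using \<epsilon> by (intro powr_less_mono2) simp_all
    then have six: "x powr \<epsilon> > 6"
      using \<epsilon> by (simp add: powr_powr)
    have "x powr (-(\<mu> + \<epsilon>)) = x powr (-\<mu>) / x powr \<epsilon>"
      using powr_diff[of x "-\<mu>" \<epsilon>] by simp
    also have "\<dots> < x powr (-\<mu>) / 6"
      using six x by (intro divide_strict_left_mono) simp_all
    also have "\<dots> = x powr (1 - \<mu>) / (6 * x)"
      using x powr_add[of x 1 "-\<mu>"] by (simp add: field_simps)
    \<comment> \<open>The exponent 1 - \<mu> is at most 0, so passing from q down to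
      \<open>k\<close> can only increase the power.\<close>
    also have "\<dots> \<le> real k powr (1 - \<mu>) / (6 * x)"
      using x k(1) \<mu> by (intro divide_right_mono powr_mono2') simp_all
    also have "\<dots> = real k powr (-\<mu>) * real k / (6 * x)"
      using k(1) powr_add[of "real k" 1 "-\<mu>"] by simp
    finally show "\<bar>cf_value b - of_int p / of_int q\<bar> > of_int q powr (-(\<mu> + \<epsilon>))"
      using k(3) unfolding x_def by linarith
  qed
qed (use \<mu> in simp)

lemma base_bound_cf_value:
  assumes b: "partial_quotients b" and growth: "growth_condition (\<lambda>x. \<beta> powr (-x)) b" and \<beta>: "\<beta> \<ge> 1"
  shows "base_bound (cf_value b) \<beta>"
  unfolding base_bound_def
proof (intro conjI allI impI)
  fix \<epsilon> :: real assume \<epsilon>: "\<epsilon> > 0"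
  obtain N :: int where N: "N > 0"
    "\<And>p q :: int. q \<ge> N \<Longrightarrow> \<exists>k::nat. k > 0 \<and> int k \<le> q \<and>
      \<bar>cf_value b - of_int p / of_int q\<bar> \<ge> \<beta> powr (- real k) * real k / (6 * of_int q)"
    using approximation_lower_bound[OF b growth] by blast
  \<comment> \<open>The loss of a factor 6 n against \<open>\<beta> + \<epsilon>\<close> is harmless
    because n \<open>c ^ n\<close> tends to 0.\<close>
  define c where "c = \<beta> / (\<beta> + \<epsilon>)"
  have c: "0 < c" "c < 1"
    using \<beta> \<epsilon> by (simp_all add: c_def)
  have "(\<lambda>n. real n * c ^ n) \<longlonglongrightarrow> 0"
    using c by (intro powser_times_n_limit_0) simp
  then have "eventually (\<lambda>n. real n * c ^ n < 1 / 6) sequentially"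
    by (rule order_tendstoD) simp
  then obtain M where M: "\<And>n. n \<ge> M \<Longrightarrow> real n * c ^ n < 1 / 6"
    by (auto simp: eventually_sequentially)
  show "\<exists>Q::int. Q > 0 \<and> (\<forall>p q::int. q \<ge> Q \<longrightarrow>
      \<bar>cf_value b - of_int p / of_int q\<bar> > 1 / (\<beta> + \<epsilon>) powi q)"
  proof (intro exI[of _ "max N (int M)"] conjI allI impI)
    show "max N (int M) > 0" using N by simp
    fix p q :: int assume q: "q \<ge> max N (int M)"
    then obtain k :: nat where k: "k > 0" "int k \<le> q"
      "\<bar>cf_value b - of_int p / of_int q\<bar> \<ge> \<beta> powr (- real k) * real k / (6 * of_int q)"
      using N(2)[of q p] by auto
    obtain n where n: "q = int n"
      using k by (metis int_nat_eq nat_0_le of_nat_0_le_iff order_trans)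
    have kn: "k \<le> n" "n > 0" "n \<ge> M"
      using k q n by simp_all
    have "\<beta> ^ k * 1 \<le> \<beta> ^ n * real k"
      using \<beta> kn k(1) by (intro mult_mono power_increasing) simp_all
    then have "1 / \<beta> ^ n \<le> real k / \<beta> ^ k"
      using \<beta> by (simp add: field_simps)
    then have "1 / \<beta> ^ n / (6 * real n) \<le> real k / \<beta> ^ k / (6 * real n)"
      by (intro divide_right_mono) simp_all
    also have "real k / \<beta> ^ k = \<beta> powr (- real k) * real k"
      using \<beta> by (simp add: powr_minus_divide powr_realpow)
    finally have "1 / \<beta> ^ n / (6 * real n) \<le> \<beta> powr (- real k) * real k / (6 * real n)" .
    \<comment> \<open>This is n \<open>c ^ n\<close> < 1/6 rearranged.\<close>
    moreover have "1 / (\<beta> + \<epsilon>) ^ n < 1 / \<beta> ^ n / (6 * real n)"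
      using M[OF kn(3)] \<beta> \<epsilon> kn(2) by (simp add: c_def power_divide field_simps)
    ultimately show "\<bar>cf_value b - of_int p / of_int q\<bar> > 1 / (\<beta> + \<epsilon>) powi q"
      using k(3) n by simp
  qed
qed (use \<beta> in simp)

section \<open>Both measures for continued fractions, and existence\<close>

lemma cf_value_irrationality_base:
  assumes "\<beta> > 1" "partial_quotients b" "growth_condition (\<lambda>x. \<beta> powr (-x)) b"
  shows "cf_value b \<notin> \<rat> \<and> irrationality_base (cf_value b) = ereal \<beta>
    \<and> approximable_to_order (cf_value b) (\<lambda>x. \<beta> powr (-x))"
proof -
  have bound: "base_bound (cf_value b) \<beta>"
    using assms by (intro base_bound_cf_value) simp_all
  note appr = approximable_cf_value[OF assms(2,3)]
  show ?thesis
    by (intro conjI base_bound_irrational[OF bound] irrationality_base_eqI[OF bound appr] appr)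
qed

lemma cf_value_irrationality_exponent:
  assumes "\<mu> > 2" "partial_quotients b" "growth_condition (\<lambda>x. x powr (-\<mu>)) b"
  shows "cf_value b \<notin> \<rat> \<and> irrationality_exponent (cf_value b) = ereal \<mu>
    \<and> approximable_to_order (cf_value b) (\<lambda>x. x powr (-\<mu>))"
proof -
  have bound: "exponent_bound (cf_value b) \<mu>"
    using assms by (intro exponent_bound_cf_value) simp_all
  note appr = approximable_cf_value[OF assms(2,3)]
  show ?thesis
    by (intro conjI exponent_bound_irrational[OF bound] irrationality_exponent_eqI[OF bound appr] appr)
qed

theorem corollary4:
  shows "(\<forall>\<beta>::real. \<beta> > 1 \<longrightarrow>
      (\<exists>\<theta>::real. \<theta> \<notin> \<rat> \<and> irrationality_base \<theta> = ereal \<beta>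
          \<and> approximable_to_order \<theta> (\<lambda>x. \<beta> powr (-x)))
    \<and> (\<forall>b. partial_quotients b \<and> growth_condition (\<lambda>x. \<beta> powr (-x)) b \<longrightarrow>
          cf_value b \<notin> \<rat> \<and> irrationality_base (cf_value b) = ereal \<beta>
          \<and> approximable_to_order (cf_value b) (\<lambda>x. \<beta> powr (-x))))
  \<and> (\<forall>\<mu>::real. \<mu> > 2 \<longrightarrow>
      (\<exists>\<theta>::real. \<theta> \<notin> \<rat> \<and> irrationality_exponent \<theta> = ereal \<mu>
          \<and> approximable_to_order \<theta> (\<lambda>x. x powr (-\<mu>)))
    \<and> (\<forall>b. partial_quotients b \<and> growth_condition (\<lambda>x. x powr (-\<mu>)) b \<longrightarrow>
          cf_value b \<notin> \<rat> \<and> irrationality_exponent (cf_value b) = ereal \<mu>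
          \<and> approximable_to_order (cf_value b) (\<lambda>x. x powr (-\<mu>))))"
proof (intro conjI allI impI)
  fix \<beta> :: real assume \<beta>: "\<beta> > 1"
  have "(\<lambda>n. \<beta> powr (- real n) * (real n)\<^sup>2) \<longlonglongrightarrow> 0"
    using \<beta> by real_asymp
  then obtain b where "partial_quotients b" "growth_condition (\<lambda>x. \<beta> powr (-x)) b"
    using \<beta> by (auto intro: greedy_partial_quotients[of "\<lambda>x. \<beta> powr (-x)"])
  then show "\<exists>\<theta>::real. \<theta> \<notin> \<rat> \<and> irrationality_base \<theta> = ereal \<beta>
      \<and> approximable_to_order \<theta> (\<lambda>x. \<beta> powr (-x))"
    using cf_value_irrationality_base[OF \<beta>] by blast
next
  fix \<mu> :: real assume \<mu>: "\<mu> > 2"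
  \<comment> \<open>For n > 0 the product is n to the power 2 - \<mu>, and \<mu> > 2 makes this
    exponent negative.\<close>
  have "(\<lambda>n. real n powr (-\<mu>) * (real n)\<^sup>2) \<longlonglongrightarrow> 0"
    using \<mu> by real_asymp
  then obtain b where "partial_quotients b" "growth_condition (\<lambda>x. x powr (-\<mu>)) b"
    by (auto intro: greedy_partial_quotients[of "\<lambda>x. x powr (-\<mu>)"])
  then show "\<exists>\<theta>::real. \<theta> \<notin> \<rat> \<and> irrationality_exponent \<theta> = ereal \<mu>
      \<and> approximable_to_order \<theta> (\<lambda>x. x powr (-\<mu>))"
    using cf_value_irrationality_exponent[OF \<mu>] by blast
qed (simp_all add: cf_value_irrationality_base cf_value_irrationality_exponent)

end
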